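(* Let $l_1,l_2,l_3,l_4>0$ with $l_1+l_2+l_3+l_4=1$ and $\tau\in\mathbb S^1$, and let $F=F_{\tau,l_1,l_2,l_3,l_4}:\mathbb S^1\to\mathbb S^1$ be the fully flipped $4$-interval exchange transformation of the circle with these parameters. If $F$ is minimal on $\mathbb S^1$, then $\tau=\frac12$.
   Context: $\mathbb S^1=\mathbb R/\mathbb Z$. Put $a_0=0$ and $a_i=l_1+\dots+l_i$ for $i=1,\dots,4$ (so $a_4=1$). The map $F_{\tau,l_1,\dots,l_4}$ is defined by $F(x)=-x+a_{i-1}+a_i+\tau \bmod 1$ for $x\in[a_{i-1},a_i)$, $i=1,\dots,4$: each interval $[a_{i-1},a_i)$ is flipped and shifted by $\tau$. Minimal means that every orbit (of a point whose orbit avoids the finitely many singular points) is dense in $\mathbb S^1$. *)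

theory Defs
  imports "HOL-Analysis.Analysis"
begin

quotient_type circle = real / "\<lambda>x y :: real. x - y \<in> \<int>"
  morphisms rep_circle circle_of
proof (rule equivpI)
  show "reflp (\<lambda>x y :: real. x - y \<in> \<int>)"
    by (simp add: reflp_def)
  show "symp (\<lambda>x y :: real. x - y \<in> \<int>)"
    by (auto simp: symp_def) (metis Ints_minus minus_diff_eq)
  show "transp (\<lambda>x y :: real. x - y \<in> \<int>)"
    by (auto simp: transp_def) (metis Ints_add diff_add_cancel add_diff_eq)
qed

instantiation circle :: ab_group_add
begin

lift_definition zero_circle :: circle is "0 :: real" .

lift_definition plus_circle :: "circle \<Rightarrow> circle \<Rightarrow> circle" is "(+) :: real \<Rightarrow> real \<Rightarrow> real"
  by (metis Ints_add add_diff_add)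

lift_definition uminus_circle :: "circle \<Rightarrow> circle" is "uminus :: real \<Rightarrow> real"
  by (metis Ints_minus minus_diff_minus)

lift_definition minus_circle :: "circle \<Rightarrow> circle \<Rightarrow> circle" is "(-) :: real \<Rightarrow> real \<Rightarrow> real"
  by (metis Ints_diff diff_diff_eq diff_diff_eq2 add_diff_eq diff_add_eq add.commute)

instance
  by standard (transfer; simp)+

end

text \<open>The quotient topology: a set is open iff its preimage in the real line is.\<close>

instantiation circle :: topological_space
begin

definition open_circle :: "circle set \<Rightarrow> bool"
  where "open_circle U \<longleftrightarrow> open (circle_of -` U)"

instance
  by standard (auto simp: open_circle_def vimage_Union)

end

text \<open>The representative in \<open>[0, 1)\<close>.\<close>

lift_definition circle_coord :: "circle \<Rightarrow> real" is "frac :: real \<Rightarrow> real"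
proof -
  fix x y :: real
  assume "x - y \<in> \<int>"
  then obtain k where "x = y + of_int k"
    by (metis Ints_cases add.commute diff_add_cancel)
  then show "frac x = frac y"
    by (simp add: frac_def)
qed

lemma circle_coord_circle_of:
  assumes "0 \<le> x" "x < 1"
  shows "circle_coord (circle_of x) = x"
  using assms by (simp add: circle_coord.abs_eq frac_eq)

definition breakpoint :: "(nat \<Rightarrow> real) \<Rightarrow> nat \<Rightarrow> real"
  where "breakpoint l i = (\<Sum>j = 1..i. l j)"

text \<open>The fully flipped \<open>n\<close>-interval exchange of the circle.  The index selected by \<open>THE\<close> is
  unique when the lengths \<open>l 1, \<dots>, l n\<close> are positive and sum to \<open>1\<close>.\<close>

definition flipped_exchange :: "nat \<Rightarrow> circle \<Rightarrow> (nat \<Rightarrow> real) \<Rightarrow> circle \<Rightarrow> circle"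
  where "flipped_exchange n \<tau> l p =
    (let x = circle_coord p;
         i = (THE i. i \<in> {1..n} \<and> x \<in> {breakpoint l (i - 1)..<breakpoint l i})
     in circle_of (- x + breakpoint l (i - 1) + breakpoint l i) + \<tau>)"

lemma flipped_exchange_circle_of:
  assumes pos: "\<And>j. j \<in> {1..n} \<Longrightarrow> l j > 0" and total: "(\<Sum>j = 1..n. l j) = 1"
    and i: "i \<in> {1..n}" and x: "x \<in> {breakpoint l (i - 1)..<breakpoint l i}"
  shows "flipped_exchange n \<tau> l (circle_of x)
       = circle_of (- x + breakpoint l (i - 1) + breakpoint l i) + \<tau>"
proof -
  have mono: "breakpoint l j \<le> breakpoint l k" if "j \<le> k" "k \<le> n" for j k
    unfolding breakpoint_def using that by (intro sum_mono2) (auto intro!: less_imp_le pos)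
  have "i - 1 \<le> n"
    using i by auto
  then have "0 \<le> x"
    using mono[of 0 "i - 1"] x by (simp add: breakpoint_def)
  moreover have "x < 1"
    using mono[of i n] i x total by (simp add: breakpoint_def)
  ultimately have coord: "circle_coord (circle_of x) = x"
    by (rule circle_coord_circle_of)
  have "(THE i. i \<in> {1..n} \<and> x \<in> {breakpoint l (i - 1)..<breakpoint l i}) = i"
  proof (rule the_equality)
    fix k
    assume k: "k \<in> {1..n} \<and> x \<in> {breakpoint l (k - 1)..<breakpoint l k}"
    have "\<not> k < i"
      using mono[of k "i - 1"] \<open>i - 1 \<le> n\<close> k x by fastforce
    moreover have "\<not> i < k"
      using mono[of i "k - 1"] k x by fastforce
    ultimately show "k = i"
      by simp
  qed (use i x in simp)
  then show ?thesis
    by (simp add: flipped_exchange_def coord)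
qed

definition singular_points :: "nat \<Rightarrow> (nat \<Rightarrow> real) \<Rightarrow> circle set"
  where "singular_points n l = (\<lambda>i. circle_of (breakpoint l i)) ` {..<n}"

text \<open>The two-sided orbit, written without \<open>inv\<close>; for a bijection \<open>f\<close>, such as the exchange above,
  it is the set of all integer iterates of \<open>x\<close>.\<close>

definition orbit_of :: "('a \<Rightarrow> 'a) \<Rightarrow> 'a \<Rightarrow> 'a set"
  where "orbit_of f x = {y. \<exists>n. y = (f ^^ n) x \<or> x = (f ^^ n) y}"

text \<open>Minimality of \<open>f\<close> with singular set \<open>S\<close>.\<close>

definition minimal_outside :: "'a::topological_space set \<Rightarrow> ('a \<Rightarrow> 'a) \<Rightarrow> bool"
  where "minimal_outside S f \<longleftrightarrow>
    (\<forall>x. orbit_of f x \<inter> S = {} \<longrightarrow> closure (orbit_of f x) = UNIV)"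

end

theory Submission
  imports Defs
begin

text \<open>For \<open>\<tau> \<noteq> 1/2\<close> a finite invariant set of points with nonsingular orbits is constructed.  As the
  inverse of the exchange with rotation \<open>\<tau>\<close> is conjugate to the one with rotation \<open>-\<tau>\<close>, we may take
  \<open>0 \<le> \<tau> < 1/2\<close>, and if some \<open>l\<^sub>i > \<tau>\<close> there are points of period two.  Otherwise attach to a point
  the interval endpoints among the preceding arc of length \<open>\<tau>\<close>, and join consecutive ones.  This is
  a graph on \<open>(0, \<tau>)\<close> whose edges are four partial reflections with domains of lengths
  \<open>\<tau> - l\<^sub>i\<close>, and iterating the exchange walks around a connected component of it.  The Euler
  characteristic, as a measure, is \<open>\<tau> - (4\<tau> - 1)/2 > 0\<close>.  Deleting all vertices of degree at most one
  again and again would preserve it if all components were infinite, yet a graph with degrees at least two has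
  nonpositive Euler characteristic; so some component is finite.\<close>

subsection \<open>Finite orbits of systems of reflections\<close>

lemma measure_lborel_reflect:
  fixes c :: real
  assumes "X \<in> sets borel"
  shows "(\<lambda>x. c - x) -` X \<in> sets borel"
    and "measure lborel ((\<lambda>x. c - x) -` X) = measure lborel X"
proof -
  have m: "(\<lambda>x. c - x) \<in> borel_measurable (borel :: real measure)"
    by measurable
  show "(\<lambda>x. c - x) -` X \<in> sets borel"
    using measurable_sets[OF m assms] by simp
  have "lborel = density (distr lborel borel (\<lambda>x. c + (-1) * x)) (\<lambda>_. ennreal \<bar>-1\<bar>)"
    by (rule lborel_real_affine) simp
  then have "lborel = distr lborel borel (\<lambda>x. c - x)"
    by (simp add: density_1)
  then have "measure lborel X = measure (distr lborel borel (\<lambda>x. c - x)) X"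
    by simp
  also have "\<dots> = measure lborel ((\<lambda>x. c - x) -` X)"
    using assms m by (simp add: measure_distr)
  finally show "measure lborel ((\<lambda>x. c - x) -` X) = measure lborel X" ..
qed

text \<open>Read as a graph on the reals: colour \<open>i\<close> joins each \<open>z\<close> in
  \<open>D i\<close> to \<open>c i - z\<close>, so every vertex has at most one edge of each
  colour.\<close>

locale reflection_system =
  fixes I :: "'i set" and D :: "'i \<Rightarrow> real set" and c :: "'i \<Rightarrow> real"
  assumes fin_I: "finite I"
    and D_borel: "\<And>i. i \<in> I \<Longrightarrow> D i \<in> sets borel"
    and D_reflect: "\<And>i z. i \<in> I \<Longrightarrow> z \<in> D i \<Longrightarrow> c i - z \<in> D i"
begin

definition edge :: "real set \<Rightarrow> 'i \<Rightarrow> real set"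
  where "edge V i = {z \<in> V. z \<in> D i \<and> c i - z \<in> V}"

definition deg :: "real set \<Rightarrow> real \<Rightarrow> nat"
  where "deg V z = card {i \<in> I. z \<in> edge V i}"

definition prune :: "real set \<Rightarrow> real set"
  where "prune V = {z \<in> V. 2 \<le> deg V z}"

text \<open>\<open>S\<close> is a union of connected components of the graph induced on
  \<open>V\<close>.\<close>

definition invariant_in :: "real set \<Rightarrow> real set \<Rightarrow> bool"
  where "invariant_in V S \<longleftrightarrow> S \<subseteq> V \<and> (\<forall>z\<in>S. \<forall>i\<in>I. z \<in> edge V i \<longrightarrow> c i - z \<in> S)"

text \<open>Twice the Euler characteristic of the graph on \<open>V\<close>, since \<open>edge V i\<close> counts every edge at
  both endpoints.\<close>

definition euler :: "real set \<Rightarrow> real"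
  where "euler V = 2 * measure lborel V - (\<Sum>i\<in>I. measure lborel (edge V i))"

lemma edge_reflect: "i \<in> I \<Longrightarrow> z \<in> edge V i \<Longrightarrow> c i - z \<in> edge V i"
  using D_reflect by (simp add: edge_def)

lemma edge_borel:
  assumes "V \<in> sets borel" "i \<in> I"
  shows "edge V i \<in> sets borel"
proof -
  have "edge V i = V \<inter> D i \<inter> (\<lambda>x. c i - x) -` V"
    by (auto simp: edge_def)
  then show ?thesis
    using assms D_borel measure_lborel_reflect(1) by auto
qed

lemma deg_eq_sum: "real (deg V z) = (\<Sum>i\<in>I. indicator (edge V i) z)"
proof -
  have "(\<Sum>i\<in>I. indicator (edge V i) z) = (\<Sum>i\<in>I. if z \<in> edge V i then 1 else (0::real))"
    by (intro sum.cong) (auto simp: indicator_def)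
  also have "\<dots> = (\<Sum>i\<in>{i \<in> I. z \<in> edge V i}. 1)"
    using fin_I by (intro sum.inter_filter[symmetric])
  finally show ?thesis
    by (simp add: deg_def)
qed

lemma deg_borel:
  assumes "V \<in> sets borel" "B \<in> sets borel"
  shows "{z \<in> V. real (deg V z) \<in> B} \<in> sets borel"
proof -
  have "(\<lambda>z. real (deg V z)) \<in> borel_measurable borel"
    unfolding deg_eq_sum using edge_borel[OF assms(1)] by measurable
  then have "(\<lambda>z. real (deg V z)) -` B \<in> sets borel"
    using assms(2) measurable_sets_borel by blast
  moreover have "{z \<in> V. real (deg V z) \<in> B} = V \<inter> (\<lambda>z. real (deg V z)) -` B"
    by auto
  ultimately show ?thesis
    using assms by auto
qed

lemma deg_le_1_unique:
  assumes "deg V z \<le> 1" "i \<in> I" "j \<in> I" "z \<in> edge V i" "z \<in> edge V j"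
  shows "i = j"
proof (rule ccontr)
  assume "i \<noteq> j"
  then have "2 = card {i, j}"
    by simp
  also have "\<dots> \<le> deg V z"
    unfolding deg_def using assms fin_I by (intro card_mono) auto
  finally show False
    using assms(1) by simp
qed

text \<open>A pruned neighbour of \<open>S\<close> has no edge except the one leading back to \<open>S\<close>.\<close>

lemma invariant_in_prune_extend:
  assumes "finite S" "invariant_in (prune V) S"
  obtains S' where "finite S'" "S \<subseteq> S'" "invariant_in V S'"
proof -
  define S' where "S' = S \<union> (\<Union>i\<in>I. (\<lambda>z. c i - z) ` {z \<in> S. z \<in> edge V i})"
  have SV: "S \<subseteq> prune V" and inv: "\<And>z i. z \<in> S \<Longrightarrow> i \<in> I \<Longrightarrow> z \<in> edge (prune V) i \<Longrightarrow> c i - z \<in> S"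
    using assms(2) by (auto simp: invariant_in_def)
  have "finite S'"
    using assms(1) fin_I by (simp add: S'_def)
  moreover have "S \<subseteq> S'"
    by (simp add: S'_def)
  moreover have "invariant_in V S'"
    unfolding invariant_in_def
  proof (intro conjI ballI impI)
    show "S' \<subseteq> V"
      using SV by (auto simp: S'_def prune_def edge_def)
    fix w j
    assume w: "w \<in> S'" and j: "j \<in> I" "w \<in> edge V j"
    show "c j - w \<in> S'"
    proof (cases "w \<in> S")
      case True
      then show ?thesis
        using j by (auto simp: S'_def)
    next
      case False
      then obtain i z where iz: "i \<in> I" "z \<in> S" "z \<in> edge V i" "w = c i - z"
        using w by (auto simp: S'_def)
      then have w_edge: "w \<in> edge V i"
        using edge_reflect by simp
      \<comment> \<open>Otherwise the edge from \<open>z\<close> to \<open>w\<close> would survive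
        in \<open>prune V\<close>, and invariance of \<open>S\<close> would force \<open>w\<close>
        into \<open>S\<close>.\<close>
      have "w \<notin> prune V"
        using inv[OF iz(2,1)] iz SV False by (auto simp: edge_def)
      then have "deg V w \<le> 1"
        using w_edge by (simp add: prune_def edge_def)
      then have "i = j"
        using deg_le_1_unique iz(1) j w_edge by blast
      then show ?thesis
        using iz by (simp add: S'_def)
    qed
  qed
  ultimately show ?thesis
    using that by blast
qed

text \<open>Deleting a leaf removes one vertex and one edge; only isolated vertices and isolated edges
  could spoil the balance, and these are finite invariant sets.\<close>

lemma prune_step:
  assumes V: "V \<in> sets borel" "emeasure lborel V < \<infinity>"
    and N: "countable N"
    and fin: "\<And>S. finite S \<Longrightarrow> invariant_in V S \<Longrightarrow> S \<subseteq> N"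
  shows "prune V \<in> sets borel" "euler V \<le> euler (prune V)"
    "measure lborel (prune V) \<le> measure lborel V - euler V"
proof -
  define L where "L = {z \<in> V. deg V z = 1}"
  define Z where "Z = {z \<in> V. deg V z = 0}"
  let ?\<mu> = "measure lborel"
  have borel: "prune V \<in> sets borel" "L \<in> sets borel" "Z \<in> sets borel"
    using deg_borel[OF V(1), of "{2..}"] deg_borel[OF V(1), of "{1}"] deg_borel[OF V(1), of "{0}"]
    by (simp_all add: prune_def L_def Z_def)
  show "prune V \<in> sets borel"
    by (rule borel(1))
  have fm: "X \<in> fmeasurable lborel" if "X \<in> sets borel" "X \<subseteq> V" for X
    using that V by (auto intro!: fmeasurableI order.strict_trans1[OF emeasure_mono[of X V lborel]])
  have split: "V = prune V \<union> L \<union> Z"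
    by (auto simp: prune_def L_def Z_def)
  have null: "X \<in> null_sets lborel" if "X \<subseteq> N" for X
    using that N countable_subset countable_imp_null_set_lborel by blast
  have "Z \<subseteq> N"
  proof
    fix z assume "z \<in> Z"
    then have "\<forall>i\<in>I. z \<notin> edge V i" "z \<in> V"
      using fin_I by (auto simp: Z_def deg_def)
    then show "z \<in> N"
      using fin[of "{z}"] by (auto simp: invariant_in_def)
  qed
  then have "?\<mu> V = ?\<mu> (prune V \<union> L)"
    using borel null by (subst split, intro measure_Un_null_set) auto
  also have "\<dots> = ?\<mu> (prune V) + ?\<mu> L"
  proof -
    have "prune V \<inter> L = {}"
      by (auto simp: prune_def L_def)
    then show ?thesis
      using fm[OF borel(1)] fm[OF borel(2)] split by (subst measure_Un3) auto
  qed
  finally have \<mu>V: "?\<mu> V = ?\<mu> (prune V) + ?\<mu> L" .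

  have int: "integrable lborel (indicator X :: real \<Rightarrow> real)" if "X \<in> sets borel" "X \<subseteq> V" for X
    using fm[OF that] by (auto simp: fmeasurable_def)
  have edge_sub: "edge V i \<subseteq> V" for i
    by (auto simp: edge_def)
  have int': "integrable lborel (\<lambda>z. 2 * indicator (prune V) z + indicator L z :: real)"
    using borel split
    by (intro Bochner_Integration.integrable_add integrable_mult_right int) auto
  \<comment> \<open>Degree count: the edge sets together cover each vertex as often as its degree,
    which is at least 2 on \<open>prune V\<close> and 1 on \<open>L\<close>. Hence
    \<open>euler V\<close> \<le> \<open>?\<mu> L\<close>, the measure lost by pruning.\<close>
  have "2 * ?\<mu> (prune V) + ?\<mu> L = (\<integral>z. 2 * indicator (prune V) z + indicator L z \<partial>lborel)"
    using borel split int by (subst Bochner_Integration.integral_add) auto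
  also have "\<dots> \<le> (\<integral>z. (\<Sum>i\<in>I. indicator (edge V i) z) \<partial>lborel)"
  proof (rule integral_mono)
    fix z
    have "z \<in> V" if "deg V z > 0"
      using that by (auto simp: deg_def card_gt_0_iff edge_def)
    then show "2 * indicator (prune V) z + indicator L z \<le> (\<Sum>i\<in>I. indicator (edge V i) z :: real)"
      unfolding deg_eq_sum[symmetric] by (auto simp: indicator_def prune_def L_def)
  qed (use int' int edge_borel[OF V(1)] edge_sub in auto)
  also have "\<dots> = (\<Sum>i\<in>I. ?\<mu> (edge V i))"
    using int edge_borel[OF V(1)] edge_sub by (subst Bochner_Integration.integral_sum) auto
  finally show "?\<mu> (prune V) \<le> ?\<mu> V - euler V"
    using \<mu>V by (simp add: euler_def)

  have L_edges: "?\<mu> L = (\<Sum>i\<in>I. ?\<mu> (edge V i \<inter> L))"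
  proof -
    have "L = (\<Union>i\<in>I. edge V i \<inter> L)"
    proof -
      have "\<exists>i\<in>I. z \<in> edge V i" if "z \<in> L" for z
      proof -
        have "card {i \<in> I. z \<in> edge V i} = 1"
          using that by (simp add: L_def deg_def)
        then obtain i where "{i \<in> I. z \<in> edge V i} = {i}"
          by (rule card_1_singletonE)
        then show ?thesis
          by blast
      qed
      then show ?thesis by auto
    qed
    moreover have "?\<mu> (\<Union>i\<in>I. edge V i \<inter> L) = (\<Sum>i\<in>I. ?\<mu> (edge V i \<inter> L))"
    proof (rule measure_finite_Union[OF fin_I])
      show "(\<lambda>i. edge V i \<inter> L) ` I \<subseteq> sets lborel"
        using edge_borel[OF V(1)] borel by auto
      show "disjoint_family_on (\<lambda>i. edge V i \<inter> L) I"
        unfolding disjoint_family_on_def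
      proof (intro ballI impI equals0I)
        fix i j z
        assume "i \<in> I" "j \<in> I" "i \<noteq> j" "z \<in> edge V i \<inter> L \<inter> (edge V j \<inter> L)"
        then show False
          using deg_le_1_unique[of V z i j] by (auto simp: L_def)
      qed
      show "emeasure lborel (edge V i \<inter> L) \<noteq> \<infinity>" if "i \<in> I" for i
        using fm[of "edge V i \<inter> L"] edge_borel[OF V(1) that] borel le_infI1[OF edge_sub]
        by (auto simp: fmeasurable_def)
    qed
    ultimately show ?thesis by simp
  qed
  \<comment> \<open>A leaf edge is lost at both ends: at the leaf, in \<open>A\<close>, and at its
    neighbour, in \<open>B\<close>. This factor 2 balances the weight 2 of a vertex in
    \<open>euler\<close>.\<close>
  have "?\<mu> (edge (prune V) i) + 2 * ?\<mu> (edge V i \<inter> L) \<le> ?\<mu> (edge V i)" if i: "i \<in> I" for i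
  proof -
    define A where "A = edge V i \<inter> L"
    define B where "B = (\<lambda>z. c i - z) -` A"
    have A: "A \<in> sets borel" "A \<subseteq> edge V i" "A \<subseteq> L"
      using edge_borel[OF V(1) i] borel by (auto simp: A_def)
    have B: "B \<in> sets borel" "?\<mu> B = ?\<mu> A"
      using measure_lborel_reflect A(1) by (auto simp: B_def)
    have BE: "B \<subseteq> edge V i"
    proof
      fix z assume "z \<in> B"
      then have "c i - z \<in> edge V i"
        using A(2) by (auto simp: B_def)
      from edge_reflect[OF i this] show "z \<in> edge V i"
        by simp
    qed
    have E: "edge (prune V) i \<in> sets borel" "edge (prune V) i \<subseteq> edge V i"
      using edge_borel[OF borel(1) i] by (auto simp: edge_def prune_def)
    have sub: "A \<subseteq> V" "B \<subseteq> V" "edge (prune V) i \<subseteq> V"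
      using A(2) BE E(2) edge_sub[of i] by blast+
    \<comment> \<open>A leaf whose neighbour is a leaf belongs to an isolated edge or loop, a finite
      invariant set.\<close>
    have "A \<inter> B \<subseteq> N"
    proof
      fix z assume z: "z \<in> A \<inter> B"
      have "invariant_in V {z, c i - z}"
        unfolding invariant_in_def
      proof (intro conjI ballI impI)
        show "{z, c i - z} \<subseteq> V"
          using z A(2) by (auto simp: edge_def)
        fix w j assume w: "w \<in> {z, c i - z}" and j: "j \<in> I" "w \<in> edge V j"
        have "w \<in> A"
          using z w by (auto simp: B_def)
        then have "w \<in> edge V i" "deg V w \<le> 1"
          by (auto simp: A_def L_def)
        then have "j = i"
          using deg_le_1_unique i j by blast
        then show "c j - w \<in> {z, c i - z}"
          using w by auto
      qed
      then show "z \<in> N"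
        using fin[of "{z, c i - z}"] by simp
    qed
    then have "A \<inter> B \<in> null_sets lborel"
      by (rule null)
    then have "?\<mu> (A \<union> B) = ?\<mu> A + ?\<mu> B"
      using fm[OF A(1)] fm[OF B(1)] sub
      by (subst measure_Un3) (auto simp: measure_def)
    moreover have "edge (prune V) i \<inter> (A \<union> B) = {}"
      by (auto simp: edge_def A_def B_def L_def prune_def)
    then have "?\<mu> (edge (prune V) i \<union> (A \<union> B)) = ?\<mu> (edge (prune V) i) + ?\<mu> (A \<union> B)"
      using fm[OF E(1)] fm[of "A \<union> B"] A(1) B(1) sub
      by (subst measure_Un3) auto
    moreover have "?\<mu> (edge (prune V) i \<union> (A \<union> B)) \<le> ?\<mu> (edge V i)"
      using fm[of "edge V i"] E A B BE edge_sub[of i] edge_borel[OF V(1) i]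
      by (intro measure_mono_fmeasurable) auto
    ultimately show ?thesis
      using B(2) by (simp add: A_def)
  qed
  then have "(\<Sum>i\<in>I. ?\<mu> (edge (prune V) i) + 2 * ?\<mu> (edge V i \<inter> L)) \<le> (\<Sum>i\<in>I. ?\<mu> (edge V i))"
    by (rule sum_mono)
  then show "euler V \<le> euler (prune V)"
    using \<mu>V L_edges by (simp add: euler_def sum.distrib sum_distrib_left[symmetric])
qed

text \<open>If all finite invariant sets lay in \<open>N\<close>, every pruning would remove at
  least the measure \<open>euler V > 0\<close>, which a set of finite measure cannot
  sustain.\<close>

lemma finite_invariant_exists:
  assumes V: "V \<in> sets borel" "emeasure lborel V < \<infinity>"
    and N: "countable N" and "euler V > 0"
  obtains S where "finite S" "invariant_in V S" "\<not> S \<subseteq> N"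
proof (rule ccontr)
  assume "\<not> thesis"
  then have no: "\<And>S. finite S \<Longrightarrow> invariant_in V S \<Longrightarrow> S \<subseteq> N"
    using that by blast
  define W where "W n = (prune ^^ n) V" for n
  have sub: "prune X \<subseteq> X" for X
    by (auto simp: prune_def)
  \<comment> \<open>The Euler characteristic never drops, so the loss per step stays at least
    \<open>euler V\<close>. The last conjunct is inherited because finite invariant sets extend back
    to the unpruned graph.\<close>
  have W: "W n \<in> sets borel \<and> emeasure lborel (W n) < \<infinity> \<and> euler V \<le> euler (W n)
      \<and> measure lborel (W n) \<le> measure lborel V - n * euler V
      \<and> (\<forall>S. finite S \<longrightarrow> invariant_in (W n) S \<longrightarrow> S \<subseteq> N)" for n
  proof (induction n)
    case 0
    then show ?case
      using V no by (simp add: W_def)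
  next
    case (Suc n)
    have "W n \<in> sets borel" "emeasure lborel (W n) < \<infinity>"
      and "\<And>S. finite S \<Longrightarrow> invariant_in (W n) S \<Longrightarrow> S \<subseteq> N"
      using Suc by simp_all
    note step = prune_step[OF this(1,2) N this(3)]
    have eq: "W (Suc n) = prune (W n)"
      by (simp add: W_def)
    have "emeasure lborel (prune (W n)) \<le> emeasure lborel (W n)"
      using Suc by (intro emeasure_mono sub) simp
    also have "\<dots> < \<infinity>"
      using Suc by simp
    finally have "emeasure lborel (prune (W n)) < \<infinity>" .
    moreover have "S \<subseteq> N" if S: "finite S" "invariant_in (prune (W n)) S" for S
    proof -
      obtain S' where S': "finite S'" "S \<subseteq> S'" "invariant_in (W n) S'"
        using invariant_in_prune_extend[OF S] .
      then have "S' \<subseteq> N"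
        using Suc by simp
      with S' show ?thesis
        by simp
    qed
    moreover have "measure lborel (prune (W n)) \<le> measure lborel V - Suc n * euler V"
      using Suc step(3) by (simp add: algebra_simps)
    ultimately show ?case
      unfolding eq using Suc step(1,2) by (meson order_trans)
  qed
  obtain n :: nat where "measure lborel V < n * euler V"
    using reals_Archimedean3[OF assms(4)] by blast
  then have "measure lborel (W n) < 0"
    using W[of n] by linarith
  then show False
    by (simp add: not_less[symmetric])
qed

end

subsection \<open>Reduction to a finite invariant set\<close>

lemma circle_of_eq_iff: "circle_of x = circle_of y \<longleftrightarrow> x - y \<in> \<int>"
  by (simp add: circle.abs_eq_iff)

lemma circle_of_add: "circle_of x + circle_of y = circle_of (x + y)"
  by (simp add: plus_circle.abs_eq)

lemma circle_of_frac [simp]: "circle_of (frac x) = circle_of x"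
  by (simp add: circle_of_eq_iff frac_def)

lemma circle_representative:
  obtains x where "0 \<le> x" "x < 1" "p = circle_of x"
proof -
  have "circle_of (rep_circle p) = p"
    using Quotient_circle by (simp add: Quotient_def)
  then show ?thesis
    using that[of "frac (rep_circle p)"] by (simp add: frac_lt_1)
qed

lemma closed_finite_circle:
  fixes P :: "circle set"
  assumes "finite P"
  shows "closed P"
proof -
  have "closed {circle_of x}" for x
  proof -
    have "circle_of -` {circle_of x} = (\<lambda>k. x + k) ` \<int>"
      by (auto simp: circle_of_eq_iff image_iff) (metis add.commute diff_add_cancel)
    then have "closed (circle_of -` {circle_of x})"
      by (simp add: closed_translation)
    then show ?thesis
      by (simp add: closed_def open_circle_def vimage_Compl)
  qed
  then have "closed {p}" for p :: circle
    by (metis circle_representative)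
  then show ?thesis
    using closed_UN[of P "\<lambda>p. {p}"] assms by simp
qed

text \<open>\<open>orbit_of\<close> also follows preimages. As \<open>f\<close> permutes the finite
  set \<open>P\<close>, and preimages of points of \<open>C\<close> lie in \<open>C\<close>, where
  \<open>f\<close> is injective, no preimage leaves \<open>P\<close>.\<close>

lemma orbit_subset_finite_invariant:
  assumes "finite P" "f ` P \<subseteq> P" "P \<subseteq> C" "inj_on f C" "f ` (- C) \<subseteq> - C" "x \<in> P"
  shows "orbit_of f x \<subseteq> P"
proof
  have "inj_on f P"
    using assms(3,4) inj_on_subset by blast
  then have onto: "f ` P = P"
    using assms(1,2) endo_inj_surj by blast
  have forward: "(f ^^ n) x \<in> P" for n
    using assms(2,6) by (induction n) auto
  have backward: "y \<in> P" if "(f ^^ n) y \<in> P" for n y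
    using that
  proof (induction n arbitrary: y)
    case (Suc n)
    then have fy: "f y \<in> P"
      by (simp add: funpow_swap1)
    then obtain p where "p \<in> P" "f y = f p"
      using onto by auto
    moreover have "y \<in> C"
      using fy assms(3,5) by blast
    ultimately show "y \<in> P"
      using assms(3,4) by (metis inj_onD subsetD)
  qed simp
  fix y assume "y \<in> orbit_of f x"
  then show "y \<in> P"
    using forward backward assms(6) unfolding orbit_of_def by blast
qed

lemma not_minimal_outside:
  fixes f :: "circle \<Rightarrow> circle"
  assumes "finite P" "P \<noteq> {}" "f ` P \<subseteq> P" "P \<subseteq> C" "inj_on f C" "f ` (- C) \<subseteq> - C"
    and "S \<inter> C = {}" "C \<noteq> UNIV"
  shows "\<not> minimal_outside S f"
proof -
  obtain x where x: "x \<in> P"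
    using assms(2) by blast
  note sub = orbit_subset_finite_invariant[OF assms(1,3-6) x]
  then have "closure (orbit_of f x) \<subseteq> P"
    by (simp add: closed_finite_circle[OF assms(1)] closure_minimal)
  then have "closure (orbit_of f x) \<noteq> UNIV"
    using assms(4,8) by blast
  moreover have "orbit_of f x \<inter> S = {}"
    using sub assms(4,7) by blast
  ultimately show ?thesis
    by (auto simp: minimal_outside_def)
qed

text \<open>To be applied to the rotation and the lengths: the maps involved shift or reflect by
  elements of \<open>H\<close>, so they preserve its complement, while countability makes
  \<open>H\<close> null.\<close>

lemma countable_subgroup_containing:
  fixes B :: "real set"
  assumes "finite B"
  obtains H where "countable H" "B \<subseteq> H" "0 \<in> H" "\<And>x y. x \<in> H \<Longrightarrow> y \<in> H \<Longrightarrow> x - y \<in> H"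
  using assms
proof (induction B arbitrary: thesis)
  case empty
  show ?case
    by (rule empty[of "{0}"]) auto
next
  case (insert b B)
  obtain H where H: "countable H" "B \<subseteq> H" "0 \<in> H" "\<And>x y. x \<in> H \<Longrightarrow> y \<in> H \<Longrightarrow> x - y \<in> H"
    using insert.IH by blast
  define K where "K = (\<lambda>(k :: int, h). of_int k * b + h) ` (UNIV \<times> H)"
  have K: "of_int k * b + h \<in> K" if "h \<in> H" for k h
    using that by (force simp: K_def)
  show ?case
  proof (rule insert.prems)
    show "countable K"
      using H(1) by (simp add: K_def)
    show "insert b B \<subseteq> K" "0 \<in> K"
      using K[of 0 1] K[of _ 0] H(2,3) by auto
    fix x y assume "x \<in> K" "y \<in> K"
    then obtain k h k' h' where "x = of_int k * b + h" "y = of_int k' * b + h'" "h \<in> H" "h' \<in> H"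
      by (auto simp: K_def)
    then show "x - y \<in> K"
      using K[of "h - h'" "k - k'"] H(4) by (simp add: algebra_simps)
  qed
qed

section \<open>Generic points and the exchange as an involution followed by a rotation\<close>

locale flipped_circle_exchange =
  fixes n :: nat and l :: "nat \<Rightarrow> real" and H :: "real set"
  assumes pos: "\<And>j. j \<in> {1..n} \<Longrightarrow> l j > 0"
    and total: "(\<Sum>j = 1..n. l j) = 1"
    and H_countable: "countable H"
    and H_zero: "0 \<in> H"
    and H_diff: "\<And>x y. x \<in> H \<Longrightarrow> y \<in> H \<Longrightarrow> x - y \<in> H"
    and H_length: "\<And>j. j \<in> {1..n} \<Longrightarrow> l j \<in> H"
begin

abbreviation a :: "nat \<Rightarrow> real"
  where "a \<equiv> breakpoint l"

abbreviation J :: "circle \<Rightarrow> circle"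
  where "J \<equiv> flipped_exchange n 0 l"

definition generic :: "circle set"
  where "generic = circle_of ` (- H)"

lemma H_uminus: "x \<in> H \<Longrightarrow> - x \<in> H"
  using H_diff[OF H_zero] by simp

lemma H_add: "x \<in> H \<Longrightarrow> y \<in> H \<Longrightarrow> x + y \<in> H"
  using H_diff[of x "- y"] H_uminus by simp

lemma H_add_iff [simp]: "x \<in> H \<Longrightarrow> x + y \<in> H \<longleftrightarrow> y \<in> H"
  using H_add H_diff[of "x + y" x] by auto

lemma H_diff_iff [simp]: "x \<in> H \<Longrightarrow> x - y \<in> H \<longleftrightarrow> y \<in> H"
  using H_diff[of x "x - y"] H_diff by auto

lemma a_zero [simp]: "a 0 = 0"
  by (simp add: breakpoint_def)

lemma a_n [simp]: "a n = 1"
  using total by (simp add: breakpoint_def)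

lemma a_Suc: "a (Suc k) = a k + l (Suc k)"
  by (simp add: breakpoint_def)

lemma a_H: "k \<le> n \<Longrightarrow> a k \<in> H"
  by (induction k) (auto simp: a_Suc H_zero H_length)

lemma H_one: "1 \<in> H"
  using a_H[of n] by simp

lemma H_of_int: "of_int k \<in> H"
proof -
  have "of_nat m \<in> H" for m
    by (induction m) (auto simp: H_zero H_one)
  then show ?thesis
    by (cases k) (metis H_uminus of_int_minus of_int_of_nat_eq)+
qed

lemma circle_of_generic [simp]: "circle_of x \<in> generic \<longleftrightarrow> x \<notin> H"
proof
  assume "circle_of x \<in> generic"
  then obtain y where "y \<notin> H" "circle_of x = circle_of y"
    by (auto simp: generic_def)
  then obtain k where "x - y = of_int k" "y \<notin> H"
    by (auto simp: circle_of_eq_iff elim: Ints_cases)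
  then show "x \<notin> H"
    using H_diff_iff[of x y] H_of_int by metis
qed (auto simp: generic_def)

lemma interval_exists:
  assumes "0 \<le> x" "x < 1"
  obtains k where "k < n" "a k \<le> x" "x < a (Suc k)"
proof -
  have "\<exists>k<m. a k \<le> x \<and> x < a (Suc k)" if "x < a m" for m
    using that
  proof (induction m)
    case (Suc m)
    then show ?case
      by (cases "x < a m") (auto simp: less_Suc_eq not_less)
  qed (use assms(1) in simp)
  from this[of n] show ?thesis
    using assms(2) that by auto
qed

lemma J_circle_of:
  assumes "k < n" "a k \<le> x" "x < a (Suc k)"
  shows "J (circle_of x) = circle_of (a k + a (Suc k) - x)"
  using flipped_exchange_circle_of[OF pos total, of "Suc k" x 0] assms
  by (simp add: algebra_simps)

lemma flipped_exchange_eq: "flipped_exchange n (circle_of t) l p = J p + circle_of t"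
  by (simp add: flipped_exchange_def Let_def)

lemma generic_interval:
  assumes "p \<in> generic"
  obtains k x where "p = circle_of x" "x \<notin> H" "k < n" "a k < x" "x < a (Suc k)"
proof -
  obtain x where x: "0 \<le> x" "x < 1" "p = circle_of x"
    by (rule circle_representative)
  then obtain k where k: "k < n" "a k \<le> x" "x < a (Suc k)"
    using interval_exists by blast
  moreover have "x \<notin> H"
    using assms x by simp
  moreover have "a k \<noteq> x"
    using a_H[of k] k \<open>x \<notin> H\<close> by auto
  ultimately show ?thesis
    using that x by force
qed

lemma J_generic_iff: "J p \<in> generic \<longleftrightarrow> p \<in> generic"
proof -
  obtain x where x: "0 \<le> x" "x < 1" "p = circle_of x"
    by (rule circle_representative)
  then obtain k where k: "k < n" "a k \<le> x" "x < a (Suc k)"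
    using interval_exists by blast
  then have "a k + a (Suc k) \<in> H"
    by (simp add: a_H)
  then show ?thesis
    using J_circle_of[OF k] x by simp
qed

text \<open>Generic points lie inside the intervals, which are reflected onto themselves. A left
  endpoint is sent to the right endpoint, which belongs to the next interval.\<close>

lemma J_involution:
  assumes "p \<in> generic"
  shows "J (J p) = p"
proof -
  obtain k x where "p = circle_of x" "k < n" "a k < x" "x < a (Suc k)"
    using generic_interval[OF assms] .
  then show ?thesis
    using J_circle_of[of k x] J_circle_of[of k "a k + a (Suc k) - x"] by simp
qed

lemma generic_add [simp]: "t \<in> H \<Longrightarrow> p + circle_of t \<in> generic \<longleftrightarrow> p \<in> generic"
  by (cases rule: circle_representative[of p]) (simp add: circle_of_add add.commute[of _ t])

lemma exchange_generic_iff: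
  "t \<in> H \<Longrightarrow> flipped_exchange n (circle_of t) l p \<in> generic \<longleftrightarrow> p \<in> generic"
  by (simp add: flipped_exchange_eq J_generic_iff)

lemma inj_on_J: "inj_on J generic"
  by (metis J_involution inj_onI)

lemma not_minimal_if_finite_invariant:
  assumes "t \<in> H" "finite P" "P \<noteq> {}" "P \<subseteq> generic" "flipped_exchange n (circle_of t) l ` P \<subseteq> P"
  shows "\<not> minimal_outside (singular_points n l) (flipped_exchange n (circle_of t) l)"
proof (rule not_minimal_outside[OF assms(2,3,5,4)])
  show "inj_on (flipped_exchange n (circle_of t) l) generic"
    using inj_on_J by (simp add: inj_on_def flipped_exchange_eq)
  show "flipped_exchange n (circle_of t) l ` (- generic) \<subseteq> - generic"
    using exchange_generic_iff[OF assms(1)] by auto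
  show "singular_points n l \<inter> generic = {}"
    by (auto simp: singular_points_def a_H)
  show "generic \<noteq> UNIV"
    using circle_of_generic[of 0] H_zero by blast
qed

text \<open>\<open>J\<close> conjugates the exchange with rotation \<open>-\<tau>\<close> to the inverse of the one with rotation \<open>\<tau>\<close>.\<close>

lemma finite_invariant_uminus:
  assumes "t \<in> H" "finite P" "P \<subseteq> generic" "flipped_exchange n (circle_of (- t)) l ` P \<subseteq> P"
  shows "flipped_exchange n (circle_of t) l ` J ` P \<subseteq> J ` P"
proof -
  let ?g = "flipped_exchange n (circle_of (- t)) l"
  have "inj_on ?g P"
    using inj_on_subset[OF inj_on_J assms(3)] by (simp add: inj_on_def flipped_exchange_eq)
  then have onto: "?g ` P = P"
    using assms(2,4) endo_inj_surj by blast
  have "flipped_exchange n (circle_of t) l (J p) \<in> J ` P" if "p \<in> P" for p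
  proof -
    \<comment> \<open>As \<open>?g\<close> permutes \<open>P\<close>, the point \<open>p\<close> has
      a preimage \<open>q\<close>, and then \<open>J p\<close> is sent to
      \<open>J q\<close>.\<close>
    obtain q where q: "q \<in> P" "p = J q + circle_of (- t)"
      using onto \<open>p \<in> P\<close> by (auto simp: flipped_exchange_eq)
    have "p \<in> generic"
      using that assms(3) by blast
    then have "flipped_exchange n (circle_of t) l (J p) = p + circle_of t"
      by (simp add: flipped_exchange_eq J_involution)
    also have "\<dots> = J q"
      using q(2) by (simp add: add.assoc circle_of_add zero_circle.abs_eq[symmetric])
    finally show ?thesis
      using q(1) by blast
  qed
  then show ?thesis
    by blast
qed

lemma exists_notin_H:
  assumes "u < v"
  obtains x where "u < x" "x < v" "x \<notin> H"
proof -
  have "\<not> {u<..<v} \<subseteq> H"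
    using H_countable countable_subset uncountable_open_interval assms by blast
  then obtain x where "x \<in> {u<..<v}" "x \<notin> H"
    by blast
  then show ?thesis
    using that[of x] by simp
qed

text \<open>The overlap of the \<open>k\<close>-th interval with its own image consists of points of period two.\<close>

lemma finite_invariant_long_interval:
  assumes "t \<in> H" "0 \<le> t" "k < n" "t < l (Suc k)"
  obtains P where "finite P" "P \<noteq> {}" "P \<subseteq> generic" "flipped_exchange n (circle_of t) l ` P \<subseteq> P"
proof -
  \<comment> \<open>The reflection maps the interval from \<open>a k + t\<close> to
    \<open>a (Suc k)\<close> onto the one from \<open>a k\<close> to \<open>a (Suc k) - t\<close>;
    rotating by \<open>t\<close> brings it back.\<close>
  obtain x where x: "a k + t < x" "x < a (Suc k)" "x \<notin> H"
    using exists_notin_H[of "a k + t" "a (Suc k)"] assms by (auto simp: a_Suc)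
  define y where "y = a k + a (Suc k) - x + t"
  have y: "a k + t < y" "y < a (Suc k)"
    using x by (auto simp: y_def)
  have "J (circle_of x) = circle_of (a k + a (Suc k) - x)"
    "J (circle_of y) = circle_of (a k + a (Suc k) - y)"
    using x(1,2) y assms(2,3) by (intro J_circle_of; simp)+
  then have "flipped_exchange n (circle_of t) l (circle_of x) = circle_of y"
    "flipped_exchange n (circle_of t) l (circle_of y) = circle_of x"
    by (simp_all add: flipped_exchange_eq circle_of_add y_def)
  moreover have "y \<notin> H"
  proof -
    have "y = (a k + a (Suc k) + t) - x" "a k + a (Suc k) + t \<in> H"
      using assms a_H by (auto simp: y_def)
    then show ?thesis
      using x by simp
  qed
  ultimately show ?thesis
    using that[of "{circle_of x, circle_of y}"] x by simp
qed

end

section \<open>Coding the exchange with short intervals by reflections\<close>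

locale flipped_4_exchange = flipped_circle_exchange 4 l H for l H +
  fixes t :: real
  assumes t_H: "t \<in> H" and t_half: "t < 1 / 2" and t_ge: "\<And>k. k < 4 \<Longrightarrow> l (Suc k) \<le> t"
begin

text \<open>Twice the centre of the reflection from the code of \<open>a k\<close> to that of
  \<open>a (Suc k)\<close>: the distance drops by \<open>l (Suc k)\<close>, and the change of parity
  turns this shift into a reflection.\<close>

definition centre :: "nat \<Rightarrow> real"
  where "centre k = (if even k then t + l (Suc k) else t - l (Suc k))"

text \<open>The codes of distances \<open>r\<close> with \<open>l (Suc k) < r < t\<close>, for which
  \<open>a (Suc k)\<close> lies in the preceding arc too.\<close>

definition dom :: "nat \<Rightarrow> real set"
  where "dom k = (if even k then {l (Suc k)<..<t} else {0<..<t - l (Suc k)})"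

sublocale reflection_system "{..<4}" dom centre
  by unfold_locales (auto simp: dom_def centre_def)

text \<open>A vertex \<open>a k\<close> seen at distance \<open>r\<close> behind the current point is encoded by one number in
  \<open>(0, t)\<close>; the parity twist makes the code independent of the orientation, so that passing to the
  next vertex is the reflection about \<open>centre k / 2\<close>.\<close>

definition code :: "nat \<Rightarrow> real \<Rightarrow> real"
  where "code k r = (if even k then r else t - r)"

text \<open>The bound \<open>r < l (Suc k)\<close> selects the nearest breakpoint behind the point;
  for invariant \<open>S\<close>, \<open>coded_walk\<close> allows farther ones.\<close>

definition coded :: "real set \<Rightarrow> circle set"
  where "coded S = {circle_of (a k + r) | k r. k < 4 \<and> 0 < r \<and> r < l (Suc k) \<and> code k r \<in> S}"

text \<open>The value is \<open>2 * t - (4 * t - 1) = 1 - 2 * t\<close>; here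
  \<open>t < 1 / 2\<close> is decisive.\<close>

lemma euler_pos: "euler {0<..<t} > 0"
proof -
  have "measure lborel (edge {0<..<t} k) = t - l (Suc k)" if "k < 4" for k
  proof -
    have "edge {0<..<t} k = dom k"
      using pos[of "Suc k"] that by (auto simp: edge_def dom_def centre_def)
    then show ?thesis
      using t_ge[OF that] by (simp add: dom_def)
  qed
  then have "(\<Sum>k<4. measure lborel (edge {0<..<t} k)) = (\<Sum>k<4. t - l (Suc k))"
    by (intro sum.cong) auto
  also have "\<dots> = 4 * t - 1"
    using total by (simp add: sum_subtractf sum.atLeast1_atMost_eq)
  finally show ?thesis
    using t_half pos[of 1] t_ge[of 0] by (simp add: euler_def)
qed

lemma finite_coded:
  assumes "finite S"
  shows "finite (coded S)"
proof -
  have "coded S \<subseteq> circle_of ` (\<Union>k<4. (\<lambda>z. a k + z) ` S \<union> (\<lambda>z. a k + (t - z)) ` S)"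
  proof
    fix p assume "p \<in> coded S"
    then obtain k r where kr: "p = circle_of (a k + r)" "k < 4" "code k r \<in> S"
      by (auto simp: coded_def)
    moreover have "r = code k r \<or> r = t - code k r"
      by (simp add: code_def)
    ultimately have "a k + r \<in> (\<lambda>z. a k + z) ` S \<union> (\<lambda>z. a k + (t - z)) ` S"
      by (metis UnCI image_eqI)
    then show "p \<in> circle_of ` (\<Union>k<4. (\<lambda>z. a k + z) ` S \<union> (\<lambda>z. a k + (t - z)) ` S)"
      using kr(1,2) by blast
  qed
  then show ?thesis
    by (rule finite_subset) (use assms in auto)
qed

context
  fixes S :: "real set"
  assumes S: "invariant_in {0<..<t} S" and S_H: "S \<inter> H = {}"
begin

lemma code_Suc:
  assumes k: "k < 4" and r: "code k r \<in> S" "l (Suc k) < r"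
  shows "code (Suc k) (r - l (Suc k)) \<in> S"
proof -
  have "0 < code k r" "code k r < t"
    using S r(1) by (auto simp: invariant_in_def)
  then have "code k r \<in> edge {0<..<t} k"
    using r(2) pos[of "Suc k"] k by (auto simp: edge_def dom_def centre_def code_def)
  then have "centre k - code k r \<in> S"
    using S r(1) k by (auto simp: invariant_in_def)
  then show ?thesis
    by (simp add: centre_def code_def algebra_simps split: if_splits)
qed

lemma code_notin_H: "code k r \<in> S \<Longrightarrow> r \<notin> H"
  using S_H t_H by (auto simp: code_def split: if_splits)

text \<open>Walk forward along the edges of the graph until the nearest breakpoint behind the point
  is reached; the shortest length \<open>m\<close> bounds the number of steps.\<close>

lemma coded_walk:
  assumes "k \<le> 4" "0 < r" "code k r \<in> S"
  shows "circle_of (a k + r) \<in> coded S"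
proof -
  define m where "m = Min (l ` {1..4})"
  have "m > 0"
    unfolding m_def using pos by (subst Min_gr_iff) auto
  have m: "m \<le> l (Suc k)" if "k < 4" for k
    unfolding m_def using that by (intro Min_le) auto
  obtain N :: nat where "r < N * m"
    using reals_Archimedean3[OF \<open>m > 0\<close>] by blast
  then show ?thesis
    using assms
  proof (induction N arbitrary: k r)
    case (Suc N)
    have step: "circle_of (a j + r) \<in> coded S" if j: "j < 4" "code j r \<in> S" for j
    proof (cases "r < l (Suc j)")
      case True
      then show ?thesis
        using j Suc.prems(2,3) by (auto simp: coded_def)
    next
      case False
      moreover have "r \<noteq> l (Suc j)"
        using code_notin_H[OF j(2)] H_length[of "Suc j"] j(1) by auto
      ultimately have "l (Suc j) < r"
        by simp
      moreover have "r - l (Suc j) < N * m"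
        using Suc.prems(1) m[OF j(1)] by (simp add: algebra_simps)
      ultimately have "circle_of (a (Suc j) + (r - l (Suc j))) \<in> coded S"
        using j by (intro Suc.IH code_Suc) auto
      then show ?thesis
        by (simp add: a_Suc)
    qed
    show ?case
    proof (cases "k = 4")
      case True
      \<comment> \<open>Passing the origin is consistent because 4 is even, so that
        \<open>code 4\<close> agrees with \<open>code 0\<close>.\<close>
      then have "circle_of (a 0 + r) \<in> coded S"
        using Suc.prems by (intro step) (auto simp: code_def)
      moreover have "circle_of (a 0 + r) = circle_of (a 4 + r)"
        by (simp add: circle_of_eq_iff)
      ultimately show ?thesis
        using True by simp
    qed (use step Suc.prems in simp)
  qed simp
qed

text \<open>A point at distance \<open>r\<close> past \<open>a k\<close> lands at distance
  \<open>t - r\<close> past \<open>a (Suc k)\<close>, and the parity twist gives both the same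
  code.\<close>

lemma coded_invariant: "flipped_exchange 4 (circle_of t) l ` coded S \<subseteq> coded S"
proof
  fix p assume "p \<in> flipped_exchange 4 (circle_of t) l ` coded S"
  then obtain k r where kr: "p = flipped_exchange 4 (circle_of t) l (circle_of (a k + r))"
    "k < 4" "0 < r" "r < l (Suc k)" "code k r \<in> S"
    by (auto simp: coded_def)
  then have "p = circle_of (a (Suc k) + (t - r))"
    using J_circle_of[of k "a k + r"]
    by (simp add: flipped_exchange_eq circle_of_add a_Suc algebra_simps)
  moreover have "0 < t - r"
    using kr t_ge[of k] by simp
  moreover have "code (Suc k) (t - r) \<in> S"
    using kr(5) by (simp add: code_def split: if_splits)
  ultimately show "p \<in> coded S"
    using kr(2) coded_walk[of "Suc k" "t - r"] by simp
qed

lemma coded_generic: "coded S \<subseteq> generic"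
  using code_notin_H by (auto simp: coded_def a_H)

lemma coded_nonempty: "S \<noteq> {} \<Longrightarrow> coded S \<noteq> {}"
proof -
  assume "S \<noteq> {}"
  then obtain z where "z \<in> S"
    by blast
  then have "circle_of (a 0 + z) \<in> coded S"
    using S by (intro coded_walk) (auto simp: code_def invariant_in_def)
  then show ?thesis
    by blast
qed

end

lemma finite_invariant_short_intervals:
  obtains P where "finite P" "P \<noteq> {}" "P \<subseteq> generic" "flipped_exchange 4 (circle_of t) l ` P \<subseteq> P"
proof -
  have "emeasure lborel {0<..<t} < \<infinity>"
    by (cases "0 \<le> t") auto
  then obtain S where S: "finite S" "invariant_in {0<..<t} S" "\<not> S \<subseteq> H"
    using finite_invariant_exists[OF _ _ H_countable euler_pos] by auto
  \<comment> \<open>The reflections therefore preserve the complement of \<open>H\<close>, so points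
    of \<open>H\<close> may be dropped from \<open>S\<close>.\<close>
  have "centre k \<in> H" if "k < 4" for k
    using that t_H H_length[of "Suc k"] by (auto simp: centre_def)
  then have inv: "invariant_in {0<..<t} (S - H)"
    using S(2) by (auto simp: invariant_in_def)
  have "S - H \<noteq> {}" "finite (S - H)"
    using S by auto
  then show ?thesis
    using that[of "coded (S - H)"] finite_coded coded_nonempty[OF inv] coded_generic[OF inv]
      coded_invariant[OF inv] by auto
qed

end

section \<open>Assembling the cases\<close>

lemma (in flipped_circle_exchange) finite_invariant_half:
  assumes "n = 4" "t \<in> H" "0 \<le> t" "t < 1 / 2"
  obtains P where "finite P" "P \<noteq> {}" "P \<subseteq> generic" "flipped_exchange n (circle_of t) l ` P \<subseteq> P"
proof (cases "\<forall>k<4. l (Suc k) \<le> t")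
  case True
  then have "flipped_4_exchange l H t"
    using assms flipped_circle_exchange_axioms
    by (auto simp: flipped_4_exchange_def flipped_4_exchange_axioms_def)
  from flipped_4_exchange.finite_invariant_short_intervals[OF this] show ?thesis
    using that assms(1) by metis
next
  case False
  then obtain k where "k < 4" "t < l (Suc k)"
    by force
  then show ?thesis
    using finite_invariant_long_interval[OF assms(2,3), of k] that assms(1) by auto
qed

theorem theorem5:
  fixes l :: "nat \<Rightarrow> real" and \<tau> :: circle
  assumes "\<And>i. i \<in> {1..4} \<Longrightarrow> l i > 0"
    and "(\<Sum>i = 1..4. l i) = 1"
    and "minimal_outside (singular_points 4 l) (flipped_exchange 4 \<tau> l)"
  shows "\<tau> = circle_of (1 / 2)"
proof (rule ccontr)
  assume "\<tau> \<noteq> circle_of (1 / 2)"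
  obtain t where t: "0 \<le> t" "t < 1" "\<tau> = circle_of t"
    by (rule circle_representative)
  then have "t \<noteq> 1 / 2"
    using \<open>\<tau> \<noteq> circle_of (1 / 2)\<close> by metis
  obtain H where H: "countable H" "insert t (l ` {1..4}) \<subseteq> H" "0 \<in> H"
    "\<And>x y. x \<in> H \<Longrightarrow> y \<in> H \<Longrightarrow> x - y \<in> H"
    using countable_subgroup_containing[of "insert t (l ` {1..4})"] by auto
  interpret flipped_circle_exchange 4 l H
    using assms H by unfold_locales auto
  have "t \<in> H"
    using H by simp
  obtain P where "finite P" "P \<noteq> {}" "P \<subseteq> generic" "flipped_exchange 4 (circle_of t) l ` P \<subseteq> P"
  proof (cases "t < 1 / 2")
    case True
    then show ?thesis
      using finite_invariant_half[of t] \<open>t \<in> H\<close> t that by auto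
  next
    case False
    \<comment> \<open>Rotation by \<open>1 - t\<close> is rotation by \<open>- t\<close>, so the
      case already treated yields an invariant set, which \<open>J\<close> carries over to rotation
      \<open>t\<close>.\<close>
    then have "1 - t < 1 / 2"
      using \<open>t \<noteq> 1 / 2\<close> by simp
    moreover have "circle_of (1 - t) = circle_of (- t)"
      by (simp add: circle_of_eq_iff)
    moreover have "1 - t \<in> H"
      using H_diff H_one \<open>t \<in> H\<close> by blast
    ultimately obtain Q where Q: "finite Q" "Q \<noteq> {}" "Q \<subseteq> generic"
      "flipped_exchange 4 (circle_of (- t)) l ` Q \<subseteq> Q"
      using finite_invariant_half[of "1 - t"] t by auto
    show ?thesis
    proof (rule that[of "J ` Q"])
      show "J ` Q \<subseteq> generic"
        using Q(3) J_generic_iff by blast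
    qed (use Q finite_invariant_uminus[OF \<open>t \<in> H\<close> Q(1,3,4)] in auto)
  qed
  then show False
    using not_minimal_if_finite_invariant[OF \<open>t \<in> H\<close>] assms(3) t(3) by blast
qed

end
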